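(* Let $G$ be a connected graph that contains at least two non-adjacent edges. The following three statements are equivalent. (1) $\overline{\Theta}_G=\overline{\Theta}_G^*$ and $\overline{\Theta}_G$ is $1$-trivial. (2) $|\Delta_{ef}|=3$ for all non-adjacent edges $e$ and $f$ of $G$. (3) $G$ is a tree.
   Context: Graphs are simple and undirected; $d$ is the shortest-path distance in $G$. For edges $e=\{a,b\}$ and $f=\{x,y\}$ the relation $\Theta_G$ on $E(G)$ is defined by $(e,f)\in\Theta_G$ iff $d(a,x)+d(b,y)\neq d(a,y)+d(b,x)$. The relation $\overline{\Theta}_G$ on $E(G)$ is defined by $(e,f)\in\overline{\Theta}_G$ iff $e=f$, or $e\neq f$ and $(e,f)\notin\Theta_G$. $\Delta_{ef}$ is the set $\{d(a,x),d(b,y),d(a,y),d(b,x)\}$. $R^*$ denotes the transitive closure of a reflexive symmetric relation $R$; an equivalence relation is $1$-trivial if it has exactly one equivalence class. Two edges $e,f$ are adjacent if $e\cap f\neq\emptyset$, and non-adjacent otherwise. *)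

theory Defs
  imports Main
begin

definition simple_graph :: "'a set \<Rightarrow> 'a set set \<Rightarrow> bool" where
  "simple_graph V E \<longleftrightarrow> (\<forall>e\<in>E. e \<subseteq> V \<and> card e = 2)"

definition gwalk :: "'a set \<Rightarrow> 'a set set \<Rightarrow> 'a \<Rightarrow> 'a list \<Rightarrow> 'a \<Rightarrow> bool" where
  "gwalk V E u p v \<longleftrightarrow>
     p \<noteq> [] \<and> hd p = u \<and> last p = v \<and> set p \<subseteq> V \<and> successively (\<lambda>x y. {x, y} \<in> E) p"

definition gconnected :: "'a set \<Rightarrow> 'a set set \<Rightarrow> bool" where
  "gconnected V E \<longleftrightarrow> V \<noteq> {} \<and> (\<forall>u\<in>V. \<forall>v\<in>V. \<exists>p. gwalk V E u p v)"

(* The length of a walk is its number of edges. The value is meaningful only when u and v are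
   joined by a walk, which always holds for vertices of a connected graph. *)
definition gdist :: "'a set \<Rightarrow> 'a set set \<Rightarrow> 'a \<Rightarrow> 'a \<Rightarrow> nat" where
  "gdist V E u v = (LEAST n. \<exists>p. gwalk V E u p v \<and> length p = Suc n)"

(* A cycle is given by its pairwise distinct vertices; the closing edge joins the last to the first. *)
definition gcycle :: "'a set \<Rightarrow> 'a set set \<Rightarrow> 'a list \<Rightarrow> bool" where
  "gcycle V E c \<longleftrightarrow>
     3 \<le> length c \<and> distinct c \<and> gwalk V E (hd c) c (last c) \<and> {last c, hd c} \<in> E"

definition tree :: "'a set \<Rightarrow> 'a set set \<Rightarrow> bool" where
  "tree V E \<longleftrightarrow> gconnected V E \<and> (\<nexists>c. gcycle V E c)"

(* Exchanging a and b, or x and y, swaps the two sides of the inequality, so the condition does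
   not depend on how the endpoints of e and f are named (see Theta_iff). *)
definition Theta :: "'a set \<Rightarrow> 'a set set \<Rightarrow> ('a set \<times> 'a set) set" where
  "Theta V E = {(e, f). e \<in> E \<and> f \<in> E \<and>
     (\<exists>a b x y. e = {a, b} \<and> f = {x, y} \<and>
        gdist V E a x + gdist V E b y \<noteq> gdist V E a y + gdist V E b x)}"

definition Theta_bar :: "'a set \<Rightarrow> 'a set set \<Rightarrow> ('a set \<times> 'a set) set" where
  "Theta_bar V E = {(e, f). e \<in> E \<and> f \<in> E \<and> (e = f \<or> e \<noteq> f \<and> (e, f) \<notin> Theta V E)}"

definition Delta :: "'a set \<Rightarrow> 'a set set \<Rightarrow> 'a set \<Rightarrow> 'a set \<Rightarrow> nat set" where
  "Delta V E e f = {gdist V E u v | u v. u \<in> e \<and> v \<in> f}"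

definition one_trivial :: "'b set \<Rightarrow> ('b \<times> 'b) set \<Rightarrow> bool" where
  "one_trivial A R \<longleftrightarrow> equiv A R \<and> card (A // R) = 1"

lemma Theta_iff:
  assumes "{a, b} \<in> E" and "{x, y} \<in> E"
  shows "({a, b}, {x, y}) \<in> Theta V E \<longleftrightarrow>
     gdist V E a x + gdist V E b y \<noteq> gdist V E a y + gdist V E b x"
  using assms unfolding Theta_def by (auto simp: doubleton_eq_iff)

lemma Delta_doubleton:
  "Delta V E {a, b} {x, y} = {gdist V E a x, gdist V E b y, gdist V E a y, gdist V E b x}"
  unfolding Delta_def by auto

end

theory Submission
  imports Defs
begin

text \<open>All three statements are equivalent to the conjunction of two local conditions: no edge has
  endpoints equidistant from some vertex, and for every vertex \<open>r\<close> each vertex has at most one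
  neighbour closer to \<open>r\<close>. A violation at minimal distance produces a pair of edges contradicting
  (1) and (2). Under the two conditions, the four distances between two distinct edges are
  constrained enough to read off (1) and (2). A vertex of a cycle farthest from a given vertex would
  violate them, and conversely a violation yields an edge together with a detour around it, hence
  a cycle.\<close>

section \<open>One-class relations, repetition-free lists and cycles\<close>

text \<open>A single class relates any two elements. Nonemptiness matters: the quotient of the empty
  set has no class at all.\<close>

lemma one_trivial_iff:
  assumes "A \<noteq> {}"
  shows "one_trivial A R \<longleftrightarrow> R = A \<times> A"
proof
  assume "one_trivial A R"
  then have eq: "equiv A R" and "card (A // R) = 1"
    by (auto simp: one_trivial_def)
  then obtain X where X: "A // R = {X}"
    by (auto simp: card_1_singleton_iff)
  have "(a, b) \<in> R" if "a \<in> A" "b \<in> A" for a b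
  proof -
    have "R `` {a} = X" "R `` {b} = X"
      using X that quotientI[of _ A R] by simp_all
    then show ?thesis
      using eq_equiv_class[OF _ eq \<open>b \<in> A\<close>, of a] by simp
  qed
  moreover have "R \<subseteq> A \<times> A"
    using eq by (rule equiv_type)
  ultimately show "R = A \<times> A"
    by auto
next
  assume R: "R = A \<times> A"
  have "A // R = {A}"
    using assms by (auto simp: quotient_def R)
  moreover have "equiv A R"
    unfolding R by (auto simp: equiv_def refl_on_def sym_def trans_def)
  ultimately show "one_trivial A R"
    by (simp add: one_trivial_def)
qed

lemma trancl_Times: "(A \<times> A)\<^sup>+ = A \<times> A"
  by (rule trancl_id) (auto simp: trans_def)

text \<open>Loops are cut off during the induction: if the new endpoint already occurs in the list,
  the list is truncated there instead of extended.\<close>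

lemma rtrancl_distinct_list:
  assumes "(x, y) \<in> R\<^sup>*"
  shows "\<exists>p. p \<noteq> [] \<and> hd p = x \<and> last p = y \<and> distinct p \<and> successively (\<lambda>u v. (u, v) \<in> R) p"
  using assms
proof (induction rule: rtrancl_induct)
  case base
  show ?case by (rule exI[of _ "[x]"]) simp
next
  case (step y z)
  then obtain p where p: "p \<noteq> []" "hd p = x" "last p = y" "distinct p"
    "successively (\<lambda>u v. (u, v) \<in> R) p" by blast
  show ?case
  proof (cases "z \<in> set p")
    case True
    then obtain q q' where pq: "p = q @ z # q'" by (meson split_list)
    with p show ?thesis
      by (intro exI[of _ "q @ [z]"]) (auto simp: successively_append_iff hd_append)
  next
    case False
    with p step show ?thesis
      by (intro exI[of _ "p @ [z]"]) (auto simp: successively_append_iff)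
  qed
qed

lemma gcycle_two_neighbours:
  assumes "gcycle V E c" "v \<in> set c"
  obtains x y where "x \<noteq> y" "x \<in> set c" "y \<in> set c" "{v, x} \<in> E" "{v, y} \<in> E"
proof -
  define n where "n = length c"
  have n: "3 \<le> n" and dist: "distinct c" and closing: "{last c, hd c} \<in> E"
    and succ: "successively (\<lambda>x y. {x, y} \<in> E) c"
    using assms(1) by (auto simp: gcycle_def gwalk_def n_def)
  have ne: "c \<noteq> []" using assms(2) by auto
  have step: "{c ! i, c ! Suc i} \<in> E" if "Suc i < n" for i
    using succ that by (auto simp: successively_conv_nth n_def)
  have close: "{c ! (n - 1), c ! 0} \<in> E"
    using closing ne by (simp add: last_conv_nth hd_conv_nth n_def)
  obtain i where i: "i < n" "v = c ! i"
    using assms(2) by (auto simp: in_set_conv_nth n_def)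
  \<comment> \<open>The cyclic neighbours of position \<open>i\<close> are used. At either end of
    the list one of them lies across the closing edge; they differ since
    \<open>3 \<le> n\<close>.\<close>
  consider "i = 0" | "i = n - 1" "i \<noteq> 0" | "i \<noteq> 0" "Suc i < n" using i by linarith
  then have "\<exists>j<n. \<exists>k<n. j \<noteq> k \<and> {v, c ! j} \<in> E \<and> {v, c ! k} \<in> E"
  proof cases
    case 1
    then show ?thesis using n i step[of 0] close
      by (intro exI[of _ 1] conjI exI[of _ "n - 1"]) (auto simp: insert_commute)
  next
    case 2
    then show ?thesis using n i step[of "n - 2"] close
      by (intro exI[of _ 0] conjI exI[of _ "n - 2"])
        (auto simp: insert_commute numeral_2_eq_2 Suc_diff_Suc)
  next
    case 3
    then show ?thesis using n i step[of "i - 1"] step[of i]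
      by (intro exI[of _ "i - 1"] conjI exI[of _ "Suc i"]) (auto simp: insert_commute)
  qed
  then obtain j k where "j < n" "k < n" "j \<noteq> k" "{v, c ! j} \<in> E" "{v, c ! k} \<in> E" by blast
  then show thesis
    using dist by (intro that[of "c ! j" "c ! k"]) (auto simp: nth_eq_iff_index_eq n_def)
qed

section \<open>Shortest-path distance in a connected graph\<close>

locale connected_graph =
  fixes V :: "'a set" and E :: "'a set set"
  assumes simple: "simple_graph V E"
    and conn: "gconnected V E"
begin

abbreviation d :: "'a \<Rightarrow> 'a \<Rightarrow> nat" where
  "d \<equiv> gdist V E"

text \<open>For a connected graph this is bipartiteness, put in terms of distances.\<close>

definition no_equidistant_edge :: bool where
  "no_equidistant_edge \<longleftrightarrow> (\<forall>r x y. r \<in> V \<longrightarrow> {x, y} \<in> E \<longrightarrow> d r x \<noteq> d r y)"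

text \<open>In a breadth-first search from \<open>r\<close>, the parent of \<open>y\<close> is not a
  matter of choice.\<close>

definition unique_closer_neighbour :: bool where
  "unique_closer_neighbour \<longleftrightarrow> (\<forall>r x x' y. r \<in> V \<longrightarrow> {x, y} \<in> E \<longrightarrow> {x', y} \<in> E \<longrightarrow>
     d r y = Suc (d r x) \<longrightarrow> d r y = Suc (d r x') \<longrightarrow> x = x')"

lemma edge_neq: "{x, y} \<in> E \<Longrightarrow> x \<noteq> y"
  using simple by (fastforce simp: simple_graph_def)

lemma edge_in_V:
  assumes "{x, y} \<in> E"
  shows "x \<in> V" "y \<in> V"
  using simple assms by (auto simp: simple_graph_def)

lemma edgeE:
  assumes "e \<in> E"
  obtains x y where "e = {x, y}" "x \<noteq> y" "x \<in> V" "y \<in> V"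
proof -
  have "card e = 2" "e \<subseteq> V"
    using simple assms by (auto simp: simple_graph_def)
  then show thesis
    using that by (auto simp: card_2_iff)
qed

lemma dist_walk:
  assumes "u \<in> V" "v \<in> V"
  obtains p where "gwalk V E u p v" "length p = Suc (d u v)"
proof -
  obtain p where p: "gwalk V E u p v"
    using conn assms by (auto simp: gconnected_def)
  then have "\<exists>p. gwalk V E u p v \<and> length p = Suc (length p - 1)"
    by (intro exI[of _ p]) (auto simp: gwalk_def)
  then have "\<exists>n p. gwalk V E u p v \<and> length p = Suc n"
    by (metis Suc_pred' gwalk_def length_greater_0_conv p)
  then have "\<exists>p. gwalk V E u p v \<and> length p = Suc (d u v)"
    unfolding gdist_def by (rule LeastI_ex)
  then show thesis using that by blast
qed

lemma dist_le: "gwalk V E u p v \<Longrightarrow> length p = Suc n \<Longrightarrow> d u v \<le> n"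
  unfolding gdist_def by (rule Least_le) blast

lemma gwalk_rev: "gwalk V E u p v \<Longrightarrow> gwalk V E v (rev p) u"
  by (auto simp: gwalk_def hd_rev last_rev successively_rev insert_commute)

lemma dist_sym:
  assumes "u \<in> V" "v \<in> V"
  shows "d u v = d v u"
proof -
  have "d b a \<le> d a b" if ab: "a \<in> V" "b \<in> V" for a b
  proof -
    obtain p where "gwalk V E a p b" "length p = Suc (d a b)"
      using ab by (rule dist_walk)
    then show ?thesis
      by (intro dist_le[of _ "rev p"]) (auto intro: gwalk_rev)
  qed
  then show ?thesis using assms by (simp add: order_antisym)
qed

lemma dist_self: "u \<in> V \<Longrightarrow> d u u = 0"
  using dist_le[of u "[u]" u 0] by (simp add: gwalk_def)

lemma dist_eq_0_iff:
  assumes "u \<in> V" "v \<in> V"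
  shows "d u v = 0 \<longleftrightarrow> u = v"
proof
  assume "d u v = 0"
  with assms obtain p where "gwalk V E u p v" "length p = Suc 0"
    by (metis dist_walk)
  then show "u = v" by (auto simp: gwalk_def length_Suc_conv)
qed (use assms dist_self in auto)

lemma dist_edge_le:
  assumes "r \<in> V" "{x, y} \<in> E"
  shows "d r y \<le> Suc (d r x)"
proof -
  have V: "x \<in> V" "y \<in> V" using edge_in_V assms by auto
  with assms obtain p where "gwalk V E r p x" "length p = Suc (d r x)"
    by (metis dist_walk)
  with V assms show ?thesis
    by (intro dist_le[of _ "p @ [y]"]) (auto simp: gwalk_def successively_append_iff)
qed

lemma dist_edge_le':
  assumes "r \<in> V" "{x, y} \<in> E"
  shows "d r x \<le> Suc (d r y)"
  using dist_edge_le[of r y x] assms by (simp add: insert_commute)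

text \<open>The penultimate vertex of a shortest walk works: dropping the last edge bounds its
  distance from above, and from below one edge changes a distance by at most one.\<close>

lemma closer_neighbour:
  assumes "r \<in> V" "x \<in> V" "d r x = Suc k"
  obtains y where "{y, x} \<in> E" "y \<in> V" "d r y = k"
proof -
  obtain p where p: "gwalk V E r p x" "length p = Suc (Suc k)"
    using dist_walk assms by metis
  then obtain q where q: "p = q @ [x]" "length q = Suc k"
    by (metis append_butlast_last_id gwalk_def length_butlast diff_Suc_1)
  define y where "y = last q"
  have "q \<noteq> []" using q by auto
  then have w: "gwalk V E r q y" and e: "{y, x} \<in> E"
    using p q by (auto simp: gwalk_def successively_append_iff y_def)
  have y: "y \<in> V" using e edge_in_V by auto
  have "d r y \<le> k" using w q dist_le by blast
  moreover have "Suc k \<le> Suc (d r y)"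
    using dist_edge_le[OF assms(1) e] assms(3) by simp
  ultimately have "d r y = k" by simp
  with e y show thesis using that by blast
qed

lemma dist_edge: "{x, y} \<in> E \<Longrightarrow> d x y = Suc 0"
  using dist_edge_le[of x x y] dist_eq_0_iff[of x y] dist_self[of x] edge_in_V[of x y]
    edge_neq[of x y] by fastforce

section \<open>Trees and distance layers\<close>

text \<open>A repetition-free \<open>R\<close>-path from \<open>x\<close> to \<open>y\<close> is
  closed into a cycle by \<open>{x, y}\<close>. Keeping \<open>R\<close> general lets each
  application choose which edges the detour may use.\<close>

lemma detour_imp_gcycle:
  assumes "(x, y) \<in> R\<^sup>*" "{x, y} \<in> E"
    and R: "\<And>u v. (u, v) \<in> R \<Longrightarrow> {u, v} \<in> E \<and> {u, v} \<noteq> {x, y}"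
  shows "\<exists>c. gcycle V E c"
proof -
  obtain p where p: "p \<noteq> []" "hd p = x" "last p = y" "distinct p"
    and succ: "successively (\<lambda>u v. (u, v) \<in> R) p"
    using rtrancl_distinct_list[OF assms(1)] by blast
  have xy: "x \<noteq> y" using assms(2) by (rule edge_neq)
  \<comment> \<open>One vertex would give \<open>x = y\<close>, and two vertices would form
    \<open>[x, y]\<close>, which runs along the edge that \<open>R\<close> excludes.\<close>
  have len: "3 \<le> length p"
  proof (rule ccontr)
    assume "\<not> 3 \<le> length p"
    then consider "length p = 0" | "length p = Suc 0" | "length p = Suc (Suc 0)" by linarith
    then show False
    proof cases
      case 3
      then have "p = [x, y]" using p by (auto simp: length_Suc_conv)
      then show False using succ R[of x y] by auto
    qed (use p xy in \<open>auto simp: length_Suc_conv\<close>)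
  qed
  have succE: "successively (\<lambda>u v. {u, v} \<in> E) p"
    using succ by (rule successively_mono) (use R in auto)
  have "u \<in> V" if "u \<in> set p" for u
  proof -
    obtain i where i: "i < length p" "u = p ! i" using \<open>u \<in> set p\<close> by (auto simp: in_set_conv_nth)
    show ?thesis
    proof (cases "Suc i < length p")
      case True
      then have "{p ! i, p ! Suc i} \<in> E" using succE by (auto simp: successively_conv_nth)
      then show ?thesis using i edge_in_V by auto
    next
      case False
      then have "u = y" using i p by (metis Suc_lessI diff_Suc_1 last_conv_nth)
      then show ?thesis using assms(2) edge_in_V by auto
    qed
  qed
  then have "gcycle V E p"
    using p len succE assms(2) by (auto simp: gcycle_def gwalk_def insert_commute)
  then show ?thesis by blast
qed

text \<open>Descending from \<open>z\<close> through closer neighbours uses only edges whose nearer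
  end is at distance below \<open>k\<close>. The relation omits all edges between vertices at
  distance \<open>k\<close> or more, so it supplies detours around such edges.\<close>

lemma reachable_below:
  assumes "r \<in> V" "z \<in> V" "d r z \<le> k"
  shows "(r, z) \<in> {(u, v). {u, v} \<in> E \<and> (d r u < k \<or> d r v < k)}\<^sup>*" (is "_ \<in> ?R\<^sup>*")
  using assms(2,3)
proof (induction "d r z" arbitrary: z)
  case 0
  then show ?case using dist_eq_0_iff assms(1) by auto
next
  case (Suc n)
  obtain y where "{y, z} \<in> E" "y \<in> V" "d r y = n"
    using closer_neighbour Suc assms(1) by metis
  moreover from this have "(r, y) \<in> ?R\<^sup>*" using Suc by auto
  moreover have "d r y < d r z" using Suc(2) \<open>d r y = n\<close> by simp
  ultimately have "(r, y) \<in> ?R\<^sup>*" "(y, z) \<in> ?R" using Suc.prems by auto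
  then show ?case by (rule rtrancl_into_rtrancl)
qed

lemma connected_below:
  assumes "r \<in> V" "z \<in> V" "d r z \<le> k" "w \<in> V" "d r w \<le> k"
  shows "(z, w) \<in> {(u, v). {u, v} \<in> E \<and> (d r u < k \<or> d r v < k)}\<^sup>*" (is "_ \<in> ?R\<^sup>*")
proof -
  have "sym (?R\<^sup>*)" by (rule sym_rtrancl) (auto simp: sym_def insert_commute)
  then have "(z, r) \<in> ?R\<^sup>*" using reachable_below[of r z k] assms by (auto dest: symD)
  then show ?thesis using reachable_below[of r w k] assms by (meson rtrancl_trans)
qed

lemma tree_iff:
  "tree V E \<longleftrightarrow> no_equidistant_edge \<and> unique_closer_neighbour"
proof
  assume "tree V E"
  then have nc: "\<not> (\<exists>c. gcycle V E c)" by (simp add: tree_def)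
  have no_equidistant_edge
    unfolding no_equidistant_edge_def
  proof (intro allI impI notI)
    fix r x y assume r: "r \<in> V" and e: "{x, y} \<in> E" and eq: "d r x = d r y"
    \<comment> \<open>Both ends of \<open>{x, y}\<close> are at distance \<open>d r x\<close>, so a
      connection through edges with a strictly nearer end avoids this edge.\<close>
    have "(x, y) \<in> {(u, v). {u, v} \<in> E \<and> (d r u < d r x \<or> d r v < d r x)}\<^sup>*"
      using connected_below[of r x "d r x" y] r edge_in_V[OF e] eq by auto
    then have "\<exists>c. gcycle V E c"
      by (rule detour_imp_gcycle[OF _ e]) (use eq in \<open>auto simp: doubleton_eq_iff\<close>)
    with nc show False ..
  qed
  moreover have unique_closer_neighbour
    unfolding unique_closer_neighbour_def
  proof (intro allI impI, rule ccontr)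
    fix r x x' y
    assume r: "r \<in> V" and e: "{x, y} \<in> E" "{x', y} \<in> E"
      and k: "d r y = Suc (d r x)" "d r y = Suc (d r x')" and ne: "x \<noteq> x'"
    let ?S = "{(u, v). {u, v} \<in> E \<and> (d r u < d r x \<or> d r v < d r x)}"
    \<comment> \<open>The detour goes from \<open>x\<close> to \<open>x'\<close> inside
      \<open>?S\<close> and then takes the edge to \<open>y\<close>. Edges of \<open>?S\<close> have
      an end nearer to \<open>r\<close> than both \<open>x\<close> and \<open>y\<close>, and the
      last edge differs from \<open>{x, y}\<close> because \<open>x \<noteq> x'\<close>.\<close>
    let ?R = "insert (x', y) ?S"
    have "(x, x') \<in> ?S\<^sup>*"
      using connected_below[of r x "d r x" x'] r edge_in_V e k by auto
    then have "(x, x') \<in> ?R\<^sup>*"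
      using rtrancl_mono[of ?S ?R] by auto
    then have "(x, y) \<in> ?R\<^sup>*" by (rule rtrancl_into_rtrancl) simp
    then have "\<exists>c. gcycle V E c"
      by (rule detour_imp_gcycle[OF _ e(1)]) (use k e ne in \<open>auto simp: doubleton_eq_iff\<close>)
    with nc show False ..
  qed
  ultimately show "no_equidistant_edge \<and> unique_closer_neighbour" ..
next
  assume *: "no_equidistant_edge \<and> unique_closer_neighbour"
  have False if c: "gcycle V E c" for c
  proof -
    have ne: "set c \<noteq> {}" and cV: "set c \<subseteq> V"
      using c by (auto simp: gcycle_def gwalk_def)
    obtain r where r: "r \<in> V" using ne cV by (metis all_not_in_conv subsetD)
    \<comment> \<open>A vertex of the cycle at maximal distance from \<open>r\<close> has no farther
      neighbour on the cycle and no equidistant one, so two distinct neighbours are closer.\<close>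
    have "Max (d r ` set c) \<in> d r ` set c" using ne by simp
    then obtain v where v: "v \<in> set c" "d r v = Max (d r ` set c)" by auto
    then have le: "d r w \<le> d r v" if "w \<in> set c" for w using that by simp
    obtain x y where xy: "x \<noteq> y" "x \<in> set c" "y \<in> set c" "{v, x} \<in> E" "{v, y} \<in> E"
      using gcycle_two_neighbours[OF c v(1)] .
    have "d r v = Suc (d r w)" if "w \<in> set c" "{v, w} \<in> E" for w
      using le[OF that(1)] dist_edge_le'[OF r that(2)] * r that(2)
      by (auto simp: no_equidistant_edge_def le_Suc_eq)
    with xy have "d r v = Suc (d r x)" "d r v = Suc (d r y)" by blast+
    moreover have "{x, v} \<in> E" "{y, v} \<in> E" using xy by (simp_all add: insert_commute)
    ultimately show False
      using * xy(1) r unfolding unique_closer_neighbour_def by metis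
  qed
  then show "tree V E" using conn by (auto simp: tree_def)
qed

section \<open>Descent from a violation to a skew pair or a triangle\<close>

lemma dist_edge_le_left:
  assumes "r \<in> V" "{x, y} \<in> E"
  shows "d y r \<le> Suc (d x r)" "d x r \<le> Suc (d y r)"
  using dist_edge_le[OF assms] dist_edge_le'[OF assms] edge_in_V[OF assms(2)] assms(1)
  by (simp_all add: dist_sym)

text \<open>One configuration against both (1) and (2): the inequality is membership in
  \<open>Theta\<close>, and two consecutive values are too few for three distinct distances.\<close>

definition skew_pair :: bool where
  "skew_pair \<longleftrightarrow> (\<exists>a b x y k. {a, b} \<in> E \<and> {x, y} \<in> E \<and> {a, b} \<inter> {x, y} = {} \<and>
     d a x + d b y \<noteq> d a y + d b x \<and> {d a x, d b y, d a y, d b x} \<subseteq> {k, Suc k})"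

text \<open>The end of the descent where the two edges found share a vertex and hence form no skew
  pair.\<close>

definition triangle :: bool where
  "triangle \<longleftrightarrow> (\<exists>a b c. {a, b} \<in> E \<and> {b, c} \<in> E \<and> {a, c} \<in> E)"

text \<open>Move \<open>r\<close> one step towards \<open>x\<close>, to \<open>s\<close>. If
  \<open>s\<close> is still equidistant from \<open>x\<close> and \<open>y\<close>, the induction
  continues from \<open>s\<close>; otherwise the edges \<open>{r, s}\<close> and
  \<open>{x, y}\<close> form a skew pair, unless \<open>s = x\<close>.\<close>

lemma equidistant_edge_imp:
  assumes "r \<in> V" "{x, y} \<in> E" "d r x = k" "d r y = k"
  shows "skew_pair \<or> triangle"
  using assms
proof (induction k arbitrary: r)
  case 0
  then show ?case using dist_eq_0_iff[of r] edge_in_V edge_neq by blast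
next
  case (Suc j)
  have V: "x \<in> V" "y \<in> V" using edge_in_V[OF Suc.prems(2)] by auto
  have "d x r = Suc j" using Suc.prems V by (simp add: dist_sym)
  then obtain s where s: "{s, r} \<in> E" "s \<in> V" "d x s = j"
    using closer_neighbour Suc.prems V by metis
  then have sx: "d s x = j" using V by (simp add: dist_sym)
  show ?case
  proof (cases "d s y = j")
    case True
    then show ?thesis using Suc.IH[OF s(2) Suc.prems(2) sx] by simp
  next
    case False
    then have sy: "d s y = Suc j"
      using dist_edge_le[OF s(2) Suc.prems(2)] dist_edge_le_left[OF V(2) s(1)] Suc.prems sx
      by simp
    show ?thesis
    \<comment> \<open>For \<open>j = 0\<close> the new vertex \<open>s\<close> is \<open>x\<close>
      itself, and \<open>r\<close>, \<open>x\<close>, \<open>y\<close> are pairwise adjacent. For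
      positive \<open>j\<close> all four distances are positive, which makes the edges
      disjoint.\<close>
    proof (cases "j = 0")
      case True
      then have "s = x" using sx s V dist_eq_0_iff by auto
      moreover have "y \<noteq> r" using Suc.prems dist_self by auto
      moreover have "{y, r} \<in> E"
      proof -
        have "d y r = Suc 0" using Suc.prems V True by (simp add: dist_sym)
        then obtain z where "{z, r} \<in> E" "z \<in> V" "d y z = 0"
          using closer_neighbour Suc.prems(1) V(2) by metis
        then show ?thesis using dist_eq_0_iff[OF V(2)] by auto
      qed
      ultimately have triangle
        unfolding triangle_def using s Suc.prems(2)
        by (intro exI[of _ r] exI[of _ x] exI[of _ y]) (auto simp: insert_commute)
      then show ?thesis ..
    next
      case False
      have "{r, s} \<inter> {x, y} = {}"
        using sx sy Suc.prems False V dist_self by auto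
      then have skew_pair
        unfolding skew_pair_def using s(1) Suc.prems sx sy
        by (intro exI[of _ r] exI[of _ s] exI[of _ x] exI[of _ y] exI[of _ j])
          (auto simp: insert_commute)
      then show ?thesis ..
    qed
  qed
qed

text \<open>Again \<open>r\<close> moves one step towards \<open>x\<close>. Either \<open>s\<close>
  inherits the violation, or \<open>s\<close> is farther from \<open>x'\<close> than
  \<open>r\<close> is, and \<open>{r, s}\<close> with \<open>{x', y}\<close> is skew. For
  \<open>k = 0\<close> both neighbours would equal \<open>r\<close>.\<close>

lemma two_closer_neighbours_imp:
  assumes "no_equidistant_edge"
    and "r \<in> V" "{x, y} \<in> E" "{x', y} \<in> E" "x \<noteq> x'"
    and "d r y = Suc k" "d r x = k" "d r x' = k"
  shows skew_pair
  using assms(2-)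
proof (induction k arbitrary: r)
  case 0
  then show ?case using dist_eq_0_iff[of r] edge_in_V by metis
next
  case (Suc j)
  have V: "x \<in> V" "x' \<in> V" "y \<in> V" using edge_in_V Suc.prems(2,3) by auto
  have "d x r = Suc j" using Suc.prems V by (simp add: dist_sym)
  then obtain s where s: "{s, r} \<in> E" "s \<in> V" "d x s = j"
    using closer_neighbour Suc.prems V by metis
  then have sx: "d s x = j" using V by (simp add: dist_sym)
  then have sy: "d s y = Suc j"
    using dist_edge_le[OF s(2) Suc.prems(2)] dist_edge_le_left[OF V(3) s(1)] Suc.prems
    by simp
  show ?case
  proof (cases "d s x' = j")
    case True
    then show ?thesis using Suc.IH[OF s(2) Suc.prems(2-4) sy sx] by simp
  next
    case False
    \<comment> \<open>Seen from \<open>x'\<close>, the edge \<open>{s, r}\<close> is not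
      equidistant; with the value \<open>j\<close> excluded only \<open>Suc (Suc j)\<close>
      remains.\<close>
    have "d x' s \<noteq> d x' r"
      using assms(1) s(1) V by (auto simp: no_equidistant_edge_def)
    then have sx': "d s x' = Suc (Suc j)"
      using False dist_edge_le_left[OF V(2) s(1)] Suc.prems s(2) V by (simp add: dist_sym)
    have "{r, s} \<inter> {x', y} = {}"
      using sx' sy Suc.prems s(2) dist_self by auto
    then show ?thesis
      unfolding skew_pair_def using s(1) Suc.prems sx' sy
      by (intro exI[of _ r] exI[of _ s] exI[of _ x'] exI[of _ y] exI[of _ "Suc j"])
        (auto simp: insert_commute)
  qed
qed

lemma skew_pair_or_triangle:
  assumes "\<not> (no_equidistant_edge \<and> unique_closer_neighbour)"
  shows "skew_pair \<or> triangle"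
proof (cases no_equidistant_edge)
  case True
  then obtain r x x' y where "r \<in> V" "{x, y} \<in> E" "{x', y} \<in> E" "x \<noteq> x'"
    "d r y = Suc (d r x)" "d r y = Suc (d r x')"
    using assms by (auto simp: unique_closer_neighbour_def)
  then show ?thesis using two_closer_neighbours_imp[OF True, of r x y x' "d r x"] by auto
next
  case False
  then show ?thesis
    using equidistant_edge_imp by (auto simp: no_equidistant_edge_def)
qed

section \<open>Skew pairs and triangles contradict (1) and (2)\<close>

lemma skew_pair_Theta:
  assumes skew_pair
  shows "\<exists>e\<in>E. \<exists>f\<in>E. e \<noteq> f \<and> (e, f) \<in> Theta V E"
proof -
  obtain a b x y where "{a, b} \<in> E" "{x, y} \<in> E" "{a, b} \<inter> {x, y} = {}"
    "d a x + d b y \<noteq> d a y + d b x"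
    using assms unfolding skew_pair_def by (elim exE conjE) (rule that)
  then show ?thesis
    using Theta_iff[of a b E x y V] by (intro bexI[of _ "{a, b}"] bexI[of _ "{x, y}"]) auto
qed

lemma triangle_Theta:
  assumes triangle
  shows "\<exists>e\<in>E. \<exists>f\<in>E. e \<noteq> f \<and> (e, f) \<in> Theta V E"
proof -
  obtain a b c where t: "{a, b} \<in> E" "{b, c} \<in> E" "{a, c} \<in> E"
    using assms unfolding triangle_def by blast
  \<comment> \<open>For the sides \<open>{a, b}\<close> and \<open>{b, c}\<close> the two sums are
    \<open>1 + 1\<close> and \<open>1 + 0\<close>.\<close>
  have "d a b = 1" "d b c = 1" "d a c = 1" "d b b = 0"
    using t dist_edge dist_self edge_in_V by auto
  moreover have "{a, b} \<noteq> {b, c}"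
    using edge_neq[OF t(3)] edge_neq[OF t(1)] by (auto simp: doubleton_eq_iff)
  ultimately show ?thesis
    using t Theta_iff[of a b E b c V]
    by (intro bexI[of _ "{a, b}"] bexI[of _ "{b, c}"]) auto
qed

lemma card_Delta_neq_3:
  assumes "Delta V E e f \<subseteq> {k, Suc k}"
  shows "card (Delta V E e f) \<noteq> 3"
  using card_mono[OF _ assms] by simp

lemma skew_pair_Delta:
  assumes skew_pair
  shows "\<exists>e\<in>E. \<exists>f\<in>E. e \<inter> f = {} \<and> card (Delta V E e f) \<noteq> 3"
proof -
  obtain a b x y k where "{a, b} \<in> E" "{x, y} \<in> E" "{a, b} \<inter> {x, y} = {}"
    "{d a x, d b y, d a y, d b x} \<subseteq> {k, Suc k}"
    using assms unfolding skew_pair_def by (elim exE conjE) (rule that)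
  moreover from this have "card (Delta V E {a, b} {x, y}) \<noteq> 3"
    by (intro card_Delta_neq_3) (simp only: Delta_doubleton)
  ultimately show ?thesis by blast
qed

text \<open>An edge disjoint from another one forces a vertex outside the triangle, hence, by
  connectedness, an edge leaving the triangle; together with the opposite side it has
  all distances in \<open>{1, 2}\<close>.\<close>
lemma triangle_Delta:
  assumes triangle and disj: "\<exists>e\<in>E. \<exists>f\<in>E. e \<inter> f = {}"
  shows "\<exists>e\<in>E. \<exists>f\<in>E. e \<inter> f = {} \<and> card (Delta V E e f) \<noteq> 3"
proof -
  obtain a b c where t: "{a, b} \<in> E" "{b, c} \<in> E" "{a, c} \<in> E"
    using assms unfolding triangle_def by blast
  let ?T = "{a, b, c}"
  have TV: "?T \<subseteq> V" using t edge_in_V by auto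
  have leave: "\<exists>u v. u \<in> ?T \<and> v \<notin> ?T \<and> {u, v} \<in> E"
  proof (rule ccontr)
    assume no: "\<not> ?thesis"
    \<comment> \<open>If no edge leaves the triangle, induction on the distance from
      \<open>a\<close> keeps every vertex inside; but two disjoint edges need four vertices.\<close>
    have "v \<in> ?T" if "v \<in> V" for v
      using that
    proof (induction "d a v" arbitrary: v)
      case 0
      then show ?case using dist_eq_0_iff[of a v] TV by auto
    next
      case (Suc n)
      then obtain u where "{u, v} \<in> E" "u \<in> V" "d a u = n"
        using closer_neighbour[of a v n] TV by (metis insert_subset)
      then show ?case using Suc no by blast
    qed
    then have "V \<subseteq> ?T" by blast
    obtain e f where ef: "e \<in> E" "f \<in> E" "e \<inter> f = {}" using disj by blast
    then obtain e1 e2 f1 f2 where "e = {e1, e2}" "e1 \<noteq> e2" "f = {f1, f2}" "f1 \<noteq> f2"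
      "e1 \<in> V" "e2 \<in> V" "f1 \<in> V" "f2 \<in> V" by (metis edgeE)
    with \<open>V \<subseteq> ?T\<close> ef show False by auto
  qed
  \<comment> \<open>The corner \<open>u\<close> where the leaving edge starts may be any of the
    three, so the corners get neutral names.\<close>
  have main: "\<exists>e\<in>E. \<exists>f\<in>E. e \<inter> f = {} \<and> card (Delta V E e f) \<noteq> 3"
    if "{p, q} \<in> E" "{p, u} \<in> E" "{q, u} \<in> E" "{u, v} \<in> E" "v \<noteq> p" "v \<noteq> q" for p q u v
  proof -
    have V: "p \<in> V" "q \<in> V" "u \<in> V" "v \<in> V" using that edge_in_V by auto
    have u: "d p u = 1" "d q u = 1" using that dist_edge by auto
    moreover have "d p v \<le> 2" "d q v \<le> 2"
      using dist_edge_le[OF _ that(4)] V u by fastforce+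
    moreover have "d p v \<noteq> 0" "d q v \<noteq> 0"
      using dist_eq_0_iff V that by auto
    ultimately have "card (Delta V E {p, q} {u, v}) \<noteq> 3"
      by (intro card_Delta_neq_3[of _ _ 1]) (auto simp: Delta_doubleton)
    moreover have "{p, q} \<inter> {u, v} = {}"
      using that edge_neq by auto
    ultimately show ?thesis using that by blast
  qed
  obtain u v where uv: "u \<in> ?T" "v \<notin> ?T" "{u, v} \<in> E" using leave by blast
  then consider "u = a" | "u = b" | "u = c" by auto
  then show ?thesis
  proof cases
    case 1
    then show ?thesis using main[of b c a v] t uv by (auto simp: insert_commute)
  next
    case 2
    then show ?thesis using main[of a c b v] t uv by (auto simp: insert_commute)
  next
    case 3
    then show ?thesis using main[of a b c v] t uv by (auto simp: insert_commute)
  qed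
qed

section \<open>Distances between two edges under the local conditions\<close>

text \<open>For positive \<open>n\<close>, take a neighbour \<open>z\<close> of \<open>x\<close>
  closer to \<open>b\<close>. Both \<open>z\<close> and \<open>y\<close> are neighbours of
  \<open>x\<close> closer to \<open>a\<close>, so they coincide, although \<open>y\<close> is
  farther from \<open>b\<close> than \<open>x\<close>. For \<open>n = 0\<close> the endpoints
  coincide crosswise.\<close>

lemma opposite_orientation_imp_eq:
  assumes unique_closer_neighbour
    and e: "{a, b} \<in> E" and f: "{x, y} \<in> E"
    and dist: "d a y = n" "d a x = Suc n" "d b x = n" "d b y = Suc n"
  shows "{a, b} = {x, y}"
proof (cases n)
  case 0
  then show ?thesis using dist dist_eq_0_iff edge_in_V[OF e] edge_in_V[OF f] by auto
next
  case (Suc m)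
  have V: "a \<in> V" "b \<in> V" "x \<in> V" "y \<in> V" using edge_in_V e f by auto
  obtain z where z: "{z, x} \<in> E" "z \<in> V" "d b z = m"
    using closer_neighbour[of b x m] V dist Suc by metis
  have "d a z = n"
    using dist_edge_le_left[OF z(2) e] dist_edge_le[OF V(1) z(1)] dist z Suc by simp
  then have "z = y"
    using assms(1)[unfolded unique_closer_neighbour_def, rule_format, of a z x y] z(1) f V(1) dist
    by (simp add: insert_commute)
  then show ?thesis using z dist Suc by simp
qed

lemma not_Theta:
  assumes no_equidistant_edge and unique: unique_closer_neighbour
    and e: "{a, b} \<in> E" and f: "{x, y} \<in> E" and ne: "{a, b} \<noteq> {x, y}"
  shows "d a x + d b y = d a y + d b x"
proof (rule ccontr)
  assume neq: "d a x + d b y \<noteq> d a y + d b x"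
  have V: "a \<in> V" "b \<in> V" "x \<in> V" "y \<in> V" using edge_in_V e f by auto
  have "d a x \<noteq> d a y" "d b x \<noteq> d b y"
    using assms V by (auto simp: no_equidistant_edge_def)
  \<comment> \<open>The distances from \<open>a\<close> and from \<open>b\<close> each change by one
    along \<open>{x, y}\<close>, and unequal sums mean opposite directions. The bounds along
    \<open>{a, b}\<close> then force the two smaller values to agree.\<close>
  then consider
    "d a x = Suc (d a y)" "d b y = Suc (d b x)" "d b x = d a y" |
    "d a y = Suc (d a x)" "d b x = Suc (d b y)" "d b y = d a x"
    using neq dist_edge_le[OF V(1) f] dist_edge_le'[OF V(1) f] dist_edge_le[OF V(2) f]
      dist_edge_le'[OF V(2) f] dist_edge_le_left[OF V(3) e] dist_edge_le_left[OF V(4) e]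
    by linarith
  then show False
  proof cases
    case 1
    then show False using opposite_orientation_imp_eq[OF unique e f] ne by auto
  next
    case 2
    then show False
      using opposite_orientation_imp_eq[OF unique e, of y x] f ne by (auto simp: insert_commute)
  qed
qed

lemma card_Delta_eq_3:
  assumes no_equidistant_edge unique_closer_neighbour
    and e: "{a, b} \<in> E" and f: "{x, y} \<in> E" and ne: "{a, b} \<noteq> {x, y}"
  shows "card (Delta V E {a, b} {x, y}) = 3"
proof -
  have V: "a \<in> V" "b \<in> V" "x \<in> V" "y \<in> V" using edge_in_V e f by auto
  have sum: "d a x + d b y = d a y + d b x" using assms by (rule not_Theta)
  have "d a x \<noteq> d a y" "d x a \<noteq> d x b"
    using assms(1) e f V by (auto simp: no_equidistant_edge_def)
  then have "d a x = Suc (d a y) \<or> d a y = Suc (d a x)"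
    and "d a x = Suc (d b x) \<or> d b x = Suc (d a x)"
    using dist_edge_le[OF V(1) f] dist_edge_le'[OF V(1) f] dist_edge_le_left[OF V(3) e]
      dist_sym[OF V(1,3)] dist_sym[OF V(2,3)] by linarith+
  \<comment> \<open>The signs of the two unit differences at \<open>d a x\<close> decide which of
    the four distances is the minimum \<open>n\<close>. The equal sums place the opposite one at
    \<open>n + 2\<close> and the other two at \<open>n + 1\<close>.\<close>
  then have "\<exists>n. {d a x, d b y, d a y, d b x} = {n, Suc n, Suc (Suc n)}"
  proof (elim disjE)
    assume "d a x = Suc (d a y)" "d a x = Suc (d b x)"
    then have "d a x = Suc (Suc (d b y))" "d a y = Suc (d b y)" "d b x = Suc (d b y)"
      using sum by linarith+
    then show ?thesis by (intro exI[of _ "d b y"]) auto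
  next
    assume "d a x = Suc (d a y)" "d b x = Suc (d a x)"
    then have "d a x = Suc (d a y)" "d b x = Suc (Suc (d a y))" "d b y = Suc (d a y)"
      using sum by linarith+
    then show ?thesis by (intro exI[of _ "d a y"]) auto
  next
    assume "d a y = Suc (d a x)" "d a x = Suc (d b x)"
    then have "d a x = Suc (d b x)" "d a y = Suc (Suc (d b x))" "d b y = Suc (d b x)"
      using sum by linarith+
    then show ?thesis by (intro exI[of _ "d b x"]) auto
  next
    assume "d a y = Suc (d a x)" "d b x = Suc (d a x)"
    then have "d a y = Suc (d a x)" "d b x = Suc (d a x)" "d b y = Suc (Suc (d a x))"
      using sum by linarith+
    then show ?thesis by (intro exI[of _ "d a x"]) auto
  qed
  then show ?thesis by (auto simp: Delta_doubleton)
qed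

section \<open>The equivalences\<close>

lemma Theta_trivial_iff:
  "(\<forall>e\<in>E. \<forall>f\<in>E. e \<noteq> f \<longrightarrow> (e, f) \<notin> Theta V E) \<longleftrightarrow>
    no_equidistant_edge \<and> unique_closer_neighbour"
proof
  assume "\<forall>e\<in>E. \<forall>f\<in>E. e \<noteq> f \<longrightarrow> (e, f) \<notin> Theta V E"
  then show "no_equidistant_edge \<and> unique_closer_neighbour"
    using skew_pair_or_triangle skew_pair_Theta triangle_Theta by blast
next
  assume *: "no_equidistant_edge \<and> unique_closer_neighbour"
  show "\<forall>e\<in>E. \<forall>f\<in>E. e \<noteq> f \<longrightarrow> (e, f) \<notin> Theta V E"
  proof (intro ballI impI)
    fix e f assume ef: "e \<in> E" "f \<in> E" "e \<noteq> f"
    then obtain a b x y where "e = {a, b}" "f = {x, y}" by (metis edgeE)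
    with ef * not_Theta[of a b x y] show "(e, f) \<notin> Theta V E" by (simp add: Theta_iff)
  qed
qed

text \<open>The disjoint edges are what the triangle case draws on: for a lone triangle the left
  side holds vacuously while the right side fails.\<close>

lemma Delta_card_3_iff:
  assumes "\<exists>e\<in>E. \<exists>f\<in>E. e \<inter> f = {}"
  shows "(\<forall>e\<in>E. \<forall>f\<in>E. e \<inter> f = {} \<longrightarrow> card (Delta V E e f) = 3) \<longleftrightarrow>
    no_equidistant_edge \<and> unique_closer_neighbour"
proof
  assume "\<forall>e\<in>E. \<forall>f\<in>E. e \<inter> f = {} \<longrightarrow> card (Delta V E e f) = 3"
  then show "no_equidistant_edge \<and> unique_closer_neighbour"
    using skew_pair_or_triangle skew_pair_Delta triangle_Delta[OF _ assms] by blast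
next
  assume *: "no_equidistant_edge \<and> unique_closer_neighbour"
  show "\<forall>e\<in>E. \<forall>f\<in>E. e \<inter> f = {} \<longrightarrow> card (Delta V E e f) = 3"
  proof (intro ballI impI)
    fix e f assume ef: "e \<in> E" "f \<in> E" "e \<inter> f = {}"
    then obtain a b x y where "e = {a, b}" "f = {x, y}" by (metis edgeE)
    with ef * show "card (Delta V E e f) = 3" by (auto intro!: card_Delta_eq_3)
  qed
qed

end

theorem lemma3p5:
  fixes V :: "'a set" and E :: "'a set set"
  assumes "simple_graph V E"
    and "gconnected V E"
    and "\<exists>e\<in>E. \<exists>f\<in>E. e \<inter> f = {}"
  shows "(Theta_bar V E = (Theta_bar V E)\<^sup>+ \<and> one_trivial E (Theta_bar V E)
            \<longleftrightarrow> (\<forall>e\<in>E. \<forall>f\<in>E. e \<inter> f = {} \<longrightarrow> card (Delta V E e f) = 3))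
       \<and> ((\<forall>e\<in>E. \<forall>f\<in>E. e \<inter> f = {} \<longrightarrow> card (Delta V E e f) = 3) \<longleftrightarrow> tree V E)"
proof -
  interpret connected_graph V E
    using assms(1,2) by unfold_locales
  have "E \<noteq> {}" using assms(3) by blast
  \<comment> \<open>One class means that \<open>Theta_bar V E\<close> is all of
    \<open>E \<times> E\<close>, which is its own transitive closure.\<close>
  then have "Theta_bar V E = (Theta_bar V E)\<^sup>+ \<and> one_trivial E (Theta_bar V E) \<longleftrightarrow>
      Theta_bar V E = E \<times> E"
    using trancl_Times[of E] by (auto simp: one_trivial_iff)
  also have "\<dots> \<longleftrightarrow> (\<forall>e\<in>E. \<forall>f\<in>E. e \<noteq> f \<longrightarrow> (e, f) \<notin> Theta V E)"
    by (auto simp: Theta_bar_def)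
  finally show ?thesis
    using Theta_trivial_iff Delta_card_3_iff[OF assms(3)] tree_iff by blast
qed

end
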